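(* Let $\hbar>0$, $q=e^{i\pi\hbar}$, and let $S,X,Y,Z$ be self-adjoint operators with scalar commutators $[X,S]=[X,Y]=[Y,Z]=[Z,X]=2\pi i\hbar$ and $[S,Y]=[S,Z]=0$. Define, with operators ordered by the order of matrix multiplication, $$M_1=X_S LX_X L X_{2Z} R X_X R X_S,\qquad M_2=X_S LX_X R X_{2Y} L X_X R X_S .$$ Then $M_i=\begin{pmatrix} qa_i&-b_i\\ c_i&-q^{-1}a_i\end{pmatrix}$, $i=1,2$, with $$a_1=e^{-X-Z}+e^{-Z},\quad b_1=e^{-X-Z+S}+(q+q^{-1})e^{-Z+S}+e^{X-Z+S}+e^{X+Z+S},\quad c_1=e^{-X-Z-S},$$ $$a_2=e^{-X-Y}+e^{-X+Y}+e^{Y},\quad b_2=e^{-X-Y+S}+(q+q^{-1})e^{Y+S}+e^{-X+Y+S}+e^{X+Y+S},\quad c_2=e^{-X-Y-S}+e^{-X+Y-S}.$$ For $i=1,2$, $$qa_ib_i=q^{-1}b_ia_i,\qquad q^{-1}a_ic_i=qc_ia_i,\qquad b_ic_i-c_ib_i=(q^2-q^{-2})a_i^2,\qquad b_ic_i=q^2a_i^2+1,$$ and $M_i^2=-\mathbb E$ (minus the $2\times 2$ identity matrix). Moreover \begin{align*} & q^{-1}b_1b_2=qb_2b_1,\qquad q^{-1}c_1c_2=qc_2c_1,\qquad a_1b_2=b_2a_1,\qquad c_1a_2=a_2c_1,\qquad qc_1b_2=q^{-1}b_2c_1,\\ & b_1a_2=a_2b_1+(q^2-q^{-2})a_1b_2,\qquad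 a_1c_2=c_2a_1+(q^2-q^{-2})c_1a_2,\\ & a_1a_2=a_2a_1+(1-q^{-2})b_2c_1=a_2a_1+(q^2-1)c_1b_2,\\ & qb_1c_2+q(q^{-2}-q^{2})a_1a_2=q^{-1}c_2b_1-q^{-1}(q^{-2}-q^{2})a_2a_1 . \end{align*}
   Context: $X_Y=\begin{pmatrix}0&-e^{Y/2}\\ e^{-Y/2}&0\end{pmatrix}$ for an operator $Y$, $R=\begin{pmatrix}1&1\\-1&0\end{pmatrix}$, $L=R^2=\begin{pmatrix}0&1\\-1&-1\end{pmatrix}$. Exponentials of linear combinations of $S,X,Y,Z$ multiply by $e^Ue^V=e^{\frac12[U,V]}e^{U+V}$ (so, for example, $e^Xe^S=q\,e^{X+S}$). *)

theory Defs
  imports "HOL-Analysis.Analysis" "HOL-Library.Function_Algebras"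
begin

text \<open>Complex Hilbert spaces; the inner product is linear in its second argument.\<close>

class complex_hilbert = banach +
  fixes scaleC :: "complex \<Rightarrow> 'a \<Rightarrow> 'a"  (infixr \<open>*\<^sub>C\<close> 75)
    and cinner :: "'a \<Rightarrow> 'a \<Rightarrow> complex"
  assumes scaleC_add_right: "c *\<^sub>C (x + y) = c *\<^sub>C x + c *\<^sub>C y"
    and scaleC_add_left: "(c + d) *\<^sub>C x = c *\<^sub>C x + d *\<^sub>C x"
    and scaleC_scaleC: "c *\<^sub>C (d *\<^sub>C x) = (c * d) *\<^sub>C x"
    and scaleC_of_real: "complex_of_real r *\<^sub>C x = r *\<^sub>R x"
    and cinner_commute: "cinner x y = cnj (cinner y x)"
    and cinner_add_right: "cinner x (y + z) = cinner x y + cinner x z"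
    and cinner_scaleC_right: "cinner x (c *\<^sub>C y) = c * cinner x y"
    and cinner_same: "cinner x x = complex_of_real ((norm x)\<^sup>2)"

definition csubspace :: "'h::complex_hilbert set \<Rightarrow> bool" where
  "csubspace V \<longleftrightarrow> 0 \<in> V \<and> (\<forall>x\<in>V. \<forall>y\<in>V. x + y \<in> V) \<and> (\<forall>c. \<forall>x\<in>V. c *\<^sub>C x \<in> V)"

text \<open>
  An unbounded operator is given by its domain \<open>d\<close> and a map \<open>A\<close>; the values of \<open>A\<close> outside \<open>d\<close>
  are irrelevant.  Self-adjointness says that the graph of \<open>A\<close> on \<open>d\<close> is the graph of its adjoint,
  which includes the equality of the two domains.
\<close>

definition adjoint_graph :: "'h::complex_hilbert set \<Rightarrow> ('h \<Rightarrow> 'h) \<Rightarrow> ('h \<times> 'h) set" where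
  "adjoint_graph d A = {(\<phi>, \<eta>). \<forall>\<psi>\<in>d. cinner \<phi> (A \<psi>) = cinner \<eta> \<psi>}"

definition self_adjoint :: "'h::complex_hilbert set \<Rightarrow> ('h \<Rightarrow> 'h) \<Rightarrow> bool" where
  "self_adjoint d A \<longleftrightarrow>
     csubspace d \<and> closure d = UNIV \<and>
     (\<forall>\<phi>\<in>d. \<forall>\<psi>\<in>d. A (\<phi> + \<psi>) = A \<phi> + A \<psi>) \<and>
     (\<forall>c. \<forall>\<psi>\<in>d. A (c *\<^sub>C \<psi>) = c *\<^sub>C A \<psi>) \<and>
     {(\<phi>, A \<phi>) |\<phi>. \<phi> \<in> d} = adjoint_graph d A"

text \<open>
  Sums, differences and negatives of operators are the pointwise ones of
  \<^theory>\<open>HOL-Library.Function_Algebras\<close>; the product of operators is composition (not the pointwise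
  product \<open>*\<close> of that theory).  Identities between unbounded operators are identities on a common
  invariant domain \<open>D\<close>.
\<close>

definition op_scale :: "complex \<Rightarrow> ('h \<Rightarrow> 'h::complex_hilbert) \<Rightarrow> 'h \<Rightarrow> 'h"  (infixr \<open>*\<^sub>O\<close> 75) where
  "c *\<^sub>O A = (\<lambda>\<psi>. c *\<^sub>C A \<psi>)"

abbreviation op_mult :: "('h \<Rightarrow> 'h) \<Rightarrow> ('h \<Rightarrow> 'h) \<Rightarrow> 'h \<Rightarrow> 'h"  (infixl \<open>\<odot>\<close> 70) where
  "A \<odot> B \<equiv> A \<circ> B"

definition op_eq_on :: "('h \<Rightarrow> 'h) \<Rightarrow> 'h set \<Rightarrow> ('h \<Rightarrow> 'h) \<Rightarrow> bool"
    (\<open>(_ \<doteq>\<^bsub>_\<^esub> _)\<close> [51, 0, 51] 50) where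
  "A \<doteq>\<^bsub>D\<^esub> B \<longleftrightarrow> (\<forall>\<psi>\<in>D. A \<psi> = B \<psi>)"

definition has_commutator ::
    "'h::complex_hilbert set \<Rightarrow> ('h \<Rightarrow> 'h) \<Rightarrow> ('h \<Rightarrow> 'h) \<Rightarrow> complex \<Rightarrow> bool" where
  "has_commutator D U V c \<longleftrightarrow> U \<odot> V - V \<odot> U \<doteq>\<^bsub>D\<^esub> c *\<^sub>O id"

definition op_exp :: "('h \<Rightarrow> 'h::complex_hilbert) \<Rightarrow> 'h \<Rightarrow> 'h" where
  "op_exp U \<psi> = (\<Sum>n. (U ^^ n) \<psi> /\<^sub>R fact n)"

definition lin_combs ::
    "('h \<Rightarrow> 'h) \<Rightarrow> ('h \<Rightarrow> 'h) \<Rightarrow> ('h \<Rightarrow> 'h) \<Rightarrow> ('h \<Rightarrow> 'h) \<Rightarrow> ('h \<Rightarrow> 'h::complex_hilbert) set" where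
  "lin_combs S X Y Z =
     {complex_of_real s *\<^sub>O S + complex_of_real x *\<^sub>O X + complex_of_real y *\<^sub>O Y + complex_of_real z *\<^sub>O Z
      |s x y z. True}"

text \<open>
  A common domain for the algebra generated by \<open>S, X, Y, Z\<close> and the exponentials of their real
  linear combinations.  Absolute convergence of the exponential series on \<open>D\<close> costs nothing: by the
  spectral theorem, a vector lies in the domain of \<open>exp (t U)\<close> for all real \<open>t\<close>, with \<open>U\<close>
  self-adjoint, iff the series converges absolutely on it for all such \<open>t U\<close>, and then the series
  is the value of the exponential.
\<close>

definition exp_domain ::
    "'h::complex_hilbert set \<Rightarrow> ('h \<Rightarrow> 'h) \<Rightarrow> ('h \<Rightarrow> 'h) \<Rightarrow> ('h \<Rightarrow> 'h) \<Rightarrow> ('h \<Rightarrow> 'h) \<Rightarrow> bool" where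
  "exp_domain D S X Y Z \<longleftrightarrow>
     csubspace D \<and> closure D = UNIV \<and>
     (\<forall>A\<in>{S, X, Y, Z}. A ` D \<subseteq> D) \<and>
     (\<forall>U\<in>lin_combs S X Y Z. \<forall>\<psi>\<in>D.
        summable (\<lambda>n. norm ((U ^^ n) \<psi>) / fact n) \<and> op_exp U \<psi> \<in> D)"

definition mat_mult ::
    "('h \<Rightarrow> 'h::complex_hilbert)^2^2 \<Rightarrow> ('h \<Rightarrow> 'h)^2^2 \<Rightarrow> ('h \<Rightarrow> 'h)^2^2"  (infixl \<open>\<otimes>\<close> 70) where
  "A \<otimes> B = (\<chi> i j. \<Sum>k\<in>UNIV. A $ i $ k \<odot> B $ k $ j)"

definition mat_eq_on :: "('h \<Rightarrow> 'h)^2^2 \<Rightarrow> 'h set \<Rightarrow> ('h \<Rightarrow> 'h)^2^2 \<Rightarrow> bool"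
    (\<open>(_ \<triangleq>\<^bsub>_\<^esub> _)\<close> [51, 0, 51] 50) where
  "A \<triangleq>\<^bsub>D\<^esub> B \<longleftrightarrow> (\<forall>i j. A $ i $ j \<doteq>\<^bsub>D\<^esub> B $ i $ j)"

definition scalar_mat :: "complex^2^2 \<Rightarrow> ('h \<Rightarrow> 'h::complex_hilbert)^2^2" where
  "scalar_mat C = (\<chi> i j. C $ i $ j *\<^sub>O id)"

definition mat2 :: "'a::zero \<Rightarrow> 'a \<Rightarrow> 'a \<Rightarrow> 'a \<Rightarrow> 'a^2^2" where
  "mat2 a b c d = vector [vector [a, b], vector [c, d]]"

definition XM :: "('h \<Rightarrow> 'h::complex_hilbert) \<Rightarrow> ('h \<Rightarrow> 'h)^2^2" where
  "XM U = mat2 0 (- op_exp ((1/2) *\<^sub>O U)) (op_exp (- ((1/2) *\<^sub>O U))) 0"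

definition R0 :: "complex^2^2" where
  "R0 = mat2 1 1 (-1) 0"

definition L0 :: "complex^2^2" where
  "L0 = R0 ** R0"

lemma L0_eq: "L0 = mat2 0 1 (-1) (-1)"
  by (simp add: L0_def R0_def mat2_def matrix_matrix_mult_def vec_eq_iff sum_2 forall_2)

definition RM :: "('h \<Rightarrow> 'h::complex_hilbert)^2^2" where
  "RM = scalar_mat R0"

definition LM :: "('h \<Rightarrow> 'h::complex_hilbert)^2^2" where
  "LM = scalar_mat L0"

end

theory Submission
  imports Defs
begin

text \<open>
  On \<open>D\<close> the operators \<open>q\<^sup>r e\<^sup>U\<close> with \<open>U = s S + x X + y Y + z Z\<close> and real \<open>r, s, x, y, z\<close> are linear
  and multiply like a Heisenberg group: the commutators of the \<open>U\<close> are scalars given by an alternating form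
  \<open>\<omega>\<close>, and \<open>e\<^sup>U e\<^sup>V = q\<^bsup>\<omega>(U,V)\<^esup> e\<^bsup>U+V\<^esup>\<close>.  Every entry of the matrices and every side of
  the relations is an integral combination of these monomials, so expanding both sides proves each
  identity.
\<close>

section \<open>Complex scalar multiplication\<close>

lemma bounded_linear_scaleC: "bounded_linear (\<lambda>x::'h::complex_hilbert. c *\<^sub>C x)"
proof (rule bounded_linear_intro[where K = "cmod c"])
  fix x y :: 'h and r :: real
  show "c *\<^sub>C (x + y) = c *\<^sub>C x + c *\<^sub>C y"
    by (rule scaleC_add_right)
  show "c *\<^sub>C (r *\<^sub>R x) = r *\<^sub>R (c *\<^sub>C x)"
    by (simp add: scaleC_of_real[symmetric] scaleC_scaleC mult.commute)
  \<comment> \<open>The axioms tie the norm to non-real scalars only through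
    \<open>cinner_same\<close>, so the norm of \<open>c *\<^sub>C x\<close> has to be computed from
    the inner product.\<close>
  have "cinner (c *\<^sub>C x) x = cnj c * cinner x x"
    by (metis cinner_commute cinner_scaleC_right complex_cnj_mult)
  then have "cinner (c *\<^sub>C x) (c *\<^sub>C x) = c * cnj c * cinner x x"
    by (simp add: cinner_scaleC_right)
  then have "complex_of_real ((norm (c *\<^sub>C x))\<^sup>2) = complex_of_real ((cmod c)\<^sup>2 * (norm x)\<^sup>2)"
    by (simp add: cinner_same complex_mult_cnj cmod_def)
  then have "(norm (c *\<^sub>C x))\<^sup>2 = (norm x * cmod c)\<^sup>2"
    by (simp only: of_real_eq_iff power_mult_distrib mult.commute)
  then show "norm (c *\<^sub>C x) \<le> norm x * cmod c"
    by (simp add: power2_eq_iff_nonneg)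
qed

lemma scaleC_scaleR: "c *\<^sub>C r *\<^sub>R x = r *\<^sub>R c *\<^sub>C (x::'h::complex_hilbert)"
  using bounded_linear.linear[OF bounded_linear_scaleC] by (rule linear_scale)

lemma scaleC_zero_right [simp]: "c *\<^sub>C (0::'h::complex_hilbert) = 0"
  using bounded_linear.linear[OF bounded_linear_scaleC] by (rule linear_0)

lemma scaleC_minus_right: "c *\<^sub>C (- x) = - (c *\<^sub>C (x::'h::complex_hilbert))"
  using bounded_linear.linear[OF bounded_linear_scaleC] by (rule linear_neg)

lemma scaleC_diff_right: "c *\<^sub>C (x - y) = c *\<^sub>C x - c *\<^sub>C (y::'h::complex_hilbert)"
  using bounded_linear.linear[OF bounded_linear_scaleC] by (rule linear_diff)

lemma scaleC_zero_left [simp]: "0 *\<^sub>C (x::'h::complex_hilbert) = 0"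
  using scaleC_of_real[of 0 x] by simp

lemma scaleC_one [simp]: "1 *\<^sub>C (x::'h::complex_hilbert) = x"
  using scaleC_of_real[of 1 x] by simp

lemma scaleC_minus_left: "(- c) *\<^sub>C (x::'h::complex_hilbert) = - (c *\<^sub>C x)"
  using scaleC_add_left[of "- c" c x] by (simp add: eq_neg_iff_add_eq_0)

lemma scaleC_diff_left: "(c - d) *\<^sub>C (x::'h::complex_hilbert) = c *\<^sub>C x - d *\<^sub>C x"
  using scaleC_add_left[of c "- d" x] by (simp add: scaleC_minus_left)

section \<open>Linear operators on an invariant domain and their commutators\<close>

text \<open>Operators are total functions whose values off their domains mean nothing, so linearity
  is asked on \<open>D\<close> only. Invariance of \<open>D\<close> is included because it makes
  compositions and powers linear on \<open>D\<close> again.\<close>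

definition linear_on_domain :: "'h::complex_hilbert set \<Rightarrow> ('h \<Rightarrow> 'h) \<Rightarrow> bool" where
  "linear_on_domain D U \<longleftrightarrow> U ` D \<subseteq> D \<and>
     (\<forall>\<phi>\<in>D. \<forall>\<psi>\<in>D. U (\<phi> + \<psi>) = U \<phi> + U \<psi>) \<and> (\<forall>c. \<forall>\<psi>\<in>D. U (c *\<^sub>C \<psi>) = c *\<^sub>C U \<psi>)"

lemma linear_on_domain_op_add:
  assumes "csubspace D" "linear_on_domain D U" "linear_on_domain D V"
  shows "linear_on_domain D (U + V)"
  using assms by (auto simp: linear_on_domain_def csubspace_def scaleC_add_right image_subset_iff)

lemma linear_on_domain_op_scale:
  assumes "csubspace D" "linear_on_domain D U"
  shows "linear_on_domain D (c *\<^sub>O U)"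
  using assms
  by (auto simp: linear_on_domain_def csubspace_def op_scale_def scaleC_add_right scaleC_scaleC
      mult.commute image_subset_iff)

lemma linear_on_domain_funpow:
  assumes "linear_on_domain D U"
  shows "linear_on_domain D (U ^^ n)"
  using assms by (induction n) (auto simp: linear_on_domain_def image_subset_iff)

lemma has_commutator_minus_swap:
  "has_commutator D U V c \<Longrightarrow> has_commutator D V U (- c)"
  by (simp add: has_commutator_def op_eq_on_def op_scale_def scaleC_minus_left algebra_simps)

lemma has_commutator_self: "has_commutator D U U 0"
  by (simp add: has_commutator_def op_eq_on_def op_scale_def)

text \<open>Linearity is treated in the right argument only;
  \<open>has_commutator_minus_swap\<close> carries it over to the left one.\<close>

lemma has_commutator_add_right:
  assumes "linear_on_domain D U" "linear_on_domain D V" "linear_on_domain D V'"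
    and "has_commutator D U V c" "has_commutator D U V' c'"
  shows "has_commutator D U (V + V') (c + c')"
  unfolding has_commutator_def op_eq_on_def
proof
  fix \<psi> assume \<psi>: "\<psi> \<in> D"
  then have comm: "U (V \<psi>) - V (U \<psi>) = c *\<^sub>C \<psi>" "U (V' \<psi>) - V' (U \<psi>) = c' *\<^sub>C \<psi>"
    using assms by (auto simp: has_commutator_def op_eq_on_def op_scale_def)
  have "U (V \<psi> + V' \<psi>) = U (V \<psi>) + U (V' \<psi>)"
    using assms \<psi> by (auto simp: linear_on_domain_def image_subset_iff)
  then show "(U \<odot> (V + V') - (V + V') \<odot> U) \<psi> = ((c + c') *\<^sub>O id) \<psi>"
    by (simp add: op_scale_def scaleC_add_left add_diff_add flip: comm)
qed

lemma has_commutator_scale_right: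
  assumes "linear_on_domain D U" "linear_on_domain D V"
    and "has_commutator D U V c"
  shows "has_commutator D U (d *\<^sub>O V) (d * c)"
  unfolding has_commutator_def op_eq_on_def
proof
  fix \<psi> assume \<psi>: "\<psi> \<in> D"
  then have "U (V \<psi>) - V (U \<psi>) = c *\<^sub>C \<psi>"
    using assms by (auto simp: has_commutator_def op_eq_on_def op_scale_def)
  moreover have "U (d *\<^sub>C V \<psi>) = d *\<^sub>C U (V \<psi>)"
    using assms \<psi> by (auto simp: linear_on_domain_def image_subset_iff)
  ultimately show "(U \<odot> (d *\<^sub>O V) - (d *\<^sub>O V) \<odot> U) \<psi> = ((d * c) *\<^sub>O id) \<psi>"
    by (simp add: op_scale_def scaleC_scaleC flip: scaleC_diff_right)
qed

section \<open>The exponential series\<close>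

text \<open>Every power of \<open>U\<close> is linear on \<open>D\<close>. Convergence passes
  additivity on to the sum of the series, and continuity of scalar multiplication lets a complex
  scalar be taken out of it.\<close>

lemma linear_on_domain_op_exp:
  assumes D: "csubspace D" and U: "linear_on_domain D U"
    and summable: "\<And>\<psi>. \<psi> \<in> D \<Longrightarrow> summable (\<lambda>n. norm ((U ^^ n) \<psi>) / fact n)"
    and range: "\<And>\<psi>. \<psi> \<in> D \<Longrightarrow> op_exp U \<psi> \<in> D"
  shows "linear_on_domain D (op_exp U)"
proof -
  have sm: "summable (\<lambda>n. (U ^^ n) \<psi> /\<^sub>R fact n)" if "\<psi> \<in> D" for \<psi>
    by (rule summable_norm_cancel) (use summable[OF that] in \<open>simp add: field_simps\<close>)
  note lin = linear_on_domain_funpow[OF U, unfolded linear_on_domain_def]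
  show ?thesis
    unfolding linear_on_domain_def
  proof (intro conjI ballI allI)
    show "op_exp U ` D \<subseteq> D"
      using range by blast
  next
    fix \<phi> \<psi> assume "\<phi> \<in> D" "\<psi> \<in> D"
    then show "op_exp U (\<phi> + \<psi>) = op_exp U \<phi> + op_exp U \<psi>"
      using lin by (simp add: op_exp_def suminf_add sm scaleR_add_right)
  next
    fix c \<psi> assume "\<psi> \<in> D"
    then have "op_exp U (c *\<^sub>C \<psi>) = (\<Sum>n. c *\<^sub>C ((U ^^ n) \<psi> /\<^sub>R fact n))"
      using lin by (simp add: op_exp_def scaleC_scaleR)
    also have "\<dots> = c *\<^sub>C op_exp U \<psi>"
      unfolding op_exp_def
      by (rule bounded_linear.suminf[OF bounded_linear_scaleC, symmetric]) (rule sm[OF \<open>\<psi> \<in> D\<close>])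
    finally show "op_exp U (c *\<^sub>C \<psi>) = c *\<^sub>C op_exp U \<psi>" .
  qed
qed

text \<open>Only the term \<open>n = 0\<close> survives, because \<open>0 ^^ 0\<close> is the
  identity.\<close>

lemma op_exp_zero [simp]: "op_exp (0::'h::complex_hilbert \<Rightarrow> 'h) = id"
proof
  fix \<psi> :: 'h
  have *: "((0::'h \<Rightarrow> 'h) ^^ n) \<psi> = (if n = 0 then \<psi> else 0)" for n
    by (cases n) auto
  have "(\<lambda>n. (if n = 0 then \<psi> else 0) /\<^sub>R fact n) = (\<lambda>n. if n = 0 then \<psi> else 0)"
    by auto
  then show "op_exp 0 \<psi> = id \<psi>"
    using sums_unique[OF sums_single[of 0 "\<lambda>_. \<psi>"]] by (simp add: op_exp_def *)
qed

section \<open>Linear combinations of the generators and their commutators\<close>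

text \<open>Gives the members of \<open>lin_combs\<close> coordinates, so that adding exponents
  becomes adding four real numbers.\<close>

definition lin_comb ::
    "('h \<Rightarrow> 'h) \<Rightarrow> ('h \<Rightarrow> 'h) \<Rightarrow> ('h \<Rightarrow> 'h) \<Rightarrow> ('h \<Rightarrow> 'h) \<Rightarrow> real \<Rightarrow> real \<Rightarrow> real \<Rightarrow> real \<Rightarrow>
      'h \<Rightarrow> 'h::complex_hilbert" where
  "lin_comb S X Y Z s x y z =
     complex_of_real s *\<^sub>O S + complex_of_real x *\<^sub>O X + complex_of_real y *\<^sub>O Y + complex_of_real z *\<^sub>O Z"

lemma lin_comb_add:
  "lin_comb S X Y Z s x y z + lin_comb S X Y Z s' x' y' z' =
     lin_comb S X Y Z (s + s') (x + x') (y + y') (z + z')"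
  by (auto simp: lin_comb_def op_scale_def scaleC_add_left)

text \<open>The alternating form \<open>\<omega>\<close> whose value is 1 on the pairs (X,S), (X,Y),
  (Y,Z), (Z,X) and 0 on (S,Y), (S,Z): the commutator divided by the common scalar
  \<open>2 * pi * \<i> * hbar\<close>.\<close>

definition commutator_form :: "real \<Rightarrow> real \<Rightarrow> real \<Rightarrow> real \<Rightarrow> real \<Rightarrow> real \<Rightarrow> real \<Rightarrow> real \<Rightarrow> real" where
  "commutator_form s x y z s' x' y' z' =
     (x * s' - s * x') + (x * y' - y * x') + (y * z' - z * y') + (z * x' - x * z')"

lemma has_commutator_lin_comb:
  fixes S X Y Z :: "'h::complex_hilbert \<Rightarrow> 'h"
  assumes D: "csubspace D"
    and lin: "linear_on_domain D S" "linear_on_domain D X" "linear_on_domain D Y" "linear_on_domain D Z"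
    and comm: "has_commutator D X S c" "has_commutator D X Y c" "has_commutator D Y Z c"
      "has_commutator D Z X c" "has_commutator D S Y 0" "has_commutator D S Z 0"
  shows "has_commutator D (lin_comb S X Y Z s x y z) (lin_comb S X Y Z s' x' y' z')
           (c * commutator_form s x y z s' x' y' z')"
proof -
  let ?r = complex_of_real and ?U = "lin_comb S X Y Z s x y z" and ?V = "lin_comb S X Y Z s' x' y' z'"
  note lins = lin linear_on_domain_op_scale[OF D] linear_on_domain_op_add[OF D]
  \<comment> \<open>For a fixed left operator \<open>A\<close>, the numbers \<open>k1\<close> to
    \<open>k4\<close> are its commutators with S, X, Y, Z; below, \<open>A\<close> runs through the
    four generators.\<close>
  have left: "has_commutator D A ?V (s' * k1 + x' * k2 + y' * k3 + z' * k4)"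
    if "linear_on_domain D A" "has_commutator D A S k1" "has_commutator D A X k2"
      "has_commutator D A Y k3" "has_commutator D A Z k4" for A and k1 k2 k3 k4 :: complex
    unfolding lin_comb_def
    by (intro has_commutator_add_right has_commutator_scale_right lins that)
  note swap = comm[THEN has_commutator_minus_swap]
  have V: "linear_on_domain D ?V"
    unfolding lin_comb_def by (intro lins)
  note sides = left[OF lin(1) has_commutator_self swap(1) comm(5,6)]
    left[OF lin(2) comm(1) has_commutator_self comm(2) swap(4)]
    left[OF lin(3) swap(5) swap(2) has_commutator_self comm(3)]
    left[OF lin(4) swap(6) comm(4) swap(3) has_commutator_self]
  \<comment> \<open>Expansion works on the right only, so \<open>[V, U]\<close> is expanded in the
    coordinates of \<open>U\<close> and then swapped back. The scalar keeps the exact shape in which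
    the rules produce it, zeros included, and is simplified only at the end.\<close>
  have "has_commutator D ?V ?U
      (?r s * - (?r s' * 0 + ?r x' * - c + ?r y' * 0 + ?r z' * 0) +
       ?r x * - (?r s' * c + ?r x' * 0 + ?r y' * c + ?r z' * - c) +
       ?r y * - (?r s' * - 0 + ?r x' * - c + ?r y' * 0 + ?r z' * c) +
       ?r z * - (?r s' * - 0 + ?r x' * c + ?r y' * - c + ?r z' * 0))"
    unfolding lin_comb_def[of S X Y Z s x y z]
    by (intro has_commutator_add_right has_commutator_scale_right lins V
        sides[THEN has_commutator_minus_swap])
  from has_commutator_minus_swap[OF this] show ?thesis
    by (rule back_subst[of "has_commutator D ?U ?V"])
      (simp add: commutator_form_def algebra_simps)
qed

section \<open>Entries of 2 x 2 operator matrices\<close>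

lemma mat2_nth [simp]:
  "mat2 a b c d $ 1 $ 1 = a" "mat2 a b c d $ 1 $ 2 = b"
  "mat2 a b c d $ 2 $ 1 = c" "mat2 a b c d $ 2 $ 2 = d"
  by (simp_all add: mat2_def)

lemma mat_mult_nth_apply:
  "((A \<otimes> B) $ i $ j) \<psi> = (A $ i $ 1) ((B $ 1 $ j) \<psi>) + (A $ i $ 2) ((B $ 2 $ j) \<psi>)"
  by (simp add: mat_mult_def sum_2)

section \<open>Calculus of monomials\<close>

text \<open>Isolates what the algebra uses: the Weyl relations for operators that are linear on
  \<open>D\<close> and preserve it. The intended \<open>W s x y z\<close> is the exponential of
  \<open>lin_comb S X Y Z s x y z\<close>; no convergence question arises from here on.\<close>

locale heisenberg_action =
  fixes hbar :: real and D :: "'h::complex_hilbert set"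
    and W :: "real \<Rightarrow> real \<Rightarrow> real \<Rightarrow> real \<Rightarrow> 'h \<Rightarrow> 'h"
  assumes csubspace: "csubspace D"
    and linear: "linear_on_domain D (W s x y z)"
    and W_zero: "W 0 0 0 0 = id"
    and W_mult: "W s x y z \<odot> W s' x' y' z' \<doteq>\<^bsub>D\<^esub>
      exp (\<i> * pi * hbar * commutator_form s x y z s' x' y' z') *\<^sub>O W (s + s') (x + x') (y + y') (z + z')"
begin

text \<open>Real powers of q with the branch fixed by the exponential, so that exponents add.
  Fractional ones occur: the halves in \<open>XM S\<close> and \<open>XM X\<close> produce fourth
  roots of q.\<close>

definition q_pow :: "real \<Rightarrow> complex" where
  "q_pow r = exp (\<i> * pi * hbar * r)"

definition monomial :: "real \<Rightarrow> real \<Rightarrow> real \<Rightarrow> real \<Rightarrow> real \<Rightarrow> 'h \<Rightarrow> 'h" where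
  "monomial r s x y z = q_pow r *\<^sub>O W s x y z"

lemma q_pow_mult: "q_pow r * q_pow r' = q_pow (r + r')"
  by (simp add: q_pow_def exp_add[symmetric] algebra_simps)

lemma q_pow_one: "exp (\<i> * pi * hbar) = q_pow 1"
  by (simp add: q_pow_def)

lemma q_pow_inverse: "inverse (q_pow r) = q_pow (- r)"
  by (simp add: q_pow_def exp_minus)

lemma q_pow_square: "(q_pow r)\<^sup>2 = q_pow (2 * r)"
  by (simp add: power2_eq_square q_pow_mult)

text \<open>The rules for monomials hold on \<open>D\<close> only; these closure facts discharge
  their side conditions under nested application.\<close>

lemma domain_closed:
  "0 \<in> D" "\<phi> \<in> D \<Longrightarrow> \<psi> \<in> D \<Longrightarrow> \<phi> + \<psi> \<in> D" "\<psi> \<in> D \<Longrightarrow> c *\<^sub>C \<psi> \<in> D" "\<psi> \<in> D \<Longrightarrow> - \<psi> \<in> D"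
  "\<phi> \<in> D \<Longrightarrow> \<psi> \<in> D \<Longrightarrow> \<phi> - \<psi> \<in> D" "\<psi> \<in> D \<Longrightarrow> monomial r s x y z \<psi> \<in> D"
proof -
  show 0: "0 \<in> D" and add: "\<And>\<phi> \<psi>. \<phi> \<in> D \<Longrightarrow> \<psi> \<in> D \<Longrightarrow> \<phi> + \<psi> \<in> D" and sc: "\<And>c \<psi>. \<psi> \<in> D \<Longrightarrow> c *\<^sub>C \<psi> \<in> D"
    using csubspace by (auto simp: csubspace_def)
  show um: "- \<psi> \<in> D" if "\<psi> \<in> D" for \<psi>
    using sc[OF that, of "- 1"] by (simp add: scaleC_minus_left)
  show "\<phi> - \<psi> \<in> D" if "\<phi> \<in> D" "\<psi> \<in> D" for \<phi> \<psi>
    using add[OF that(1) um[OF that(2)]] by simp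
  show "\<psi> \<in> D \<Longrightarrow> monomial r s x y z \<psi> \<in> D"
    using linear[of s x y z] sc by (auto simp: monomial_def op_scale_def linear_on_domain_def)
qed

lemma monomial_add:
  "\<phi> \<in> D \<Longrightarrow> \<psi> \<in> D \<Longrightarrow> monomial r s x y z (\<phi> + \<psi>) = monomial r s x y z \<phi> + monomial r s x y z \<psi>"
  using linear[of s x y z] by (simp add: monomial_def op_scale_def linear_on_domain_def scaleC_add_right)

lemma monomial_scaleC:
  "\<psi> \<in> D \<Longrightarrow> monomial r s x y z (c *\<^sub>C \<psi>) = c *\<^sub>C monomial r s x y z \<psi>"
  using linear[of s x y z]
  by (simp add: monomial_def op_scale_def linear_on_domain_def scaleC_scaleC mult.commute)

lemma monomial_uminus: "\<psi> \<in> D \<Longrightarrow> monomial r s x y z (- \<psi>) = - monomial r s x y z \<psi>"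
  using monomial_scaleC[of \<psi> r s x y z "- 1"] by (simp add: scaleC_minus_left)

lemma monomial_diff:
  "\<phi> \<in> D \<Longrightarrow> \<psi> \<in> D \<Longrightarrow> monomial r s x y z (\<phi> - \<psi>) = monomial r s x y z \<phi> - monomial r s x y z \<psi>"
  using monomial_add[of \<phi> "- \<psi>" r s x y z] by (simp add: monomial_uminus domain_closed)

lemma monomial_zero: "monomial r s x y z 0 = 0"
  using monomial_scaleC[of 0 r s x y z 0] by (simp add: domain_closed)

lemma scaleC_monomial: "q_pow r *\<^sub>C monomial r' s x y z \<psi> = monomial (r + r') s x y z \<psi>"
  by (simp add: monomial_def op_scale_def scaleC_scaleC q_pow_mult)

lemma monomial_one: "monomial 0 0 0 0 0 \<psi> = \<psi>"
  by (simp add: monomial_def op_scale_def q_pow_def W_zero)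

text \<open>The Heisenberg group law: the exponent of q is the central coordinate, and
  \<open>commutator_form\<close> is the cocycle added to it.\<close>

lemma monomial_mult:
  assumes "\<psi> \<in> D"
  shows "monomial r s x y z (monomial r' s' x' y' z' \<psi>) =
    monomial (r + r' + commutator_form s x y z s' x' y' z') (s + s') (x + x') (y + y') (z + z') \<psi>"
proof -
  have W: "W s' x' y' z' \<psi> \<in> D"
    using assms linear[of s' x' y' z'] by (auto simp: linear_on_domain_def)
  have "monomial r s x y z (monomial r' s' x' y' z' \<psi>) = q_pow r' *\<^sub>C q_pow r *\<^sub>C W s x y z (W s' x' y' z' \<psi>)"
    using monomial_scaleC[OF W, of r s x y z "q_pow r'"] by (simp add: monomial_def op_scale_def)
  also have "W s x y z (W s' x' y' z' \<psi>) = q_pow (commutator_form s x y z s' x' y' z') *\<^sub>C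
      W (s + s') (x + x') (y + y') (z + z') \<psi>"
    using W_mult[of s x y z s' x' y' z'] assms by (simp add: op_eq_on_def op_scale_def q_pow_def)
  finally show ?thesis
    by (simp add: monomial_def op_scale_def scaleC_scaleC q_pow_mult ac_simps)
qed

lemma W_monomial: "W s x y z = monomial 0 s x y z"
  by (simp add: monomial_def op_scale_def q_pow_def)

text \<open>A rewrite system for normal forms: monomials are distributed over sums, compositions
  merge into one monomial, and powers of q are absorbed into the first coordinate. What remains is a
  signed sum of monomials applied to one vector.\<close>

lemmas monomial_simps = domain_closed monomial_add monomial_uminus monomial_diff monomial_zero monomial_one
  monomial_scaleC scaleC_monomial monomial_mult commutator_form_def
  q_pow_one q_pow_inverse q_pow_square q_pow_mult op_scale_def
  scaleC_add_right scaleC_add_left scaleC_minus_right scaleC_minus_left scaleC_diff_right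
  scaleC_diff_left scaleC_scaleC

end

section \<open>Matrix entries and relations by expansion into monomials\<close>

theorem mainTheorem4:
  fixes hbar :: real and q :: complex
    and dS dX dY dZ D :: "'h::complex_hilbert set"
    and S X Y Z :: "'h \<Rightarrow> 'h"
    and M1 M2 :: "('h \<Rightarrow> 'h)^2^2"
    and a1 b1 c1 a2 b2 c2 :: "'h \<Rightarrow> 'h"
  assumes hbar: "hbar > 0"
    and self_adjoint: "self_adjoint dS S" "self_adjoint dX X" "self_adjoint dY Y" "self_adjoint dZ Z"
    and domain: "D \<subseteq> dS \<inter> dX \<inter> dY \<inter> dZ" "exp_domain D S X Y Z"
    and commutators:
      "has_commutator D X S (2 * pi * \<i> * hbar)"
      "has_commutator D X Y (2 * pi * \<i> * hbar)"
      "has_commutator D Y Z (2 * pi * \<i> * hbar)"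
      "has_commutator D Z X (2 * pi * \<i> * hbar)"
      "has_commutator D S Y 0"
      "has_commutator D S Z 0"
    and exponentials:
      "\<And>U V c. U \<in> lin_combs S X Y Z \<Longrightarrow> V \<in> lin_combs S X Y Z \<Longrightarrow> has_commutator D U V c \<Longrightarrow>
         op_exp U \<odot> op_exp V \<doteq>\<^bsub>D\<^esub> exp (c / 2) *\<^sub>O op_exp (U + V)"
  defines "q \<equiv> exp (\<i> * pi * hbar)"
    and "M1 \<equiv> XM S \<otimes> LM \<otimes> XM X \<otimes> LM \<otimes> XM (2 *\<^sub>O Z) \<otimes> RM \<otimes> XM X \<otimes> RM \<otimes> XM S"
    and "M2 \<equiv> XM S \<otimes> LM \<otimes> XM X \<otimes> RM \<otimes> XM (2 *\<^sub>O Y) \<otimes> LM \<otimes> XM X \<otimes> RM \<otimes> XM S"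
    and "a1 \<equiv> op_exp (- X - Z) + op_exp (- Z)"
    and "b1 \<equiv> op_exp (- X - Z + S) + (q + inverse q) *\<^sub>O op_exp (- Z + S)
               + op_exp (X - Z + S) + op_exp (X + Z + S)"
    and "c1 \<equiv> op_exp (- X - Z - S)"
    and "a2 \<equiv> op_exp (- X - Y) + op_exp (- X + Y) + op_exp Y"
    and "b2 \<equiv> op_exp (- X - Y + S) + (q + inverse q) *\<^sub>O op_exp (Y + S)
               + op_exp (- X + Y + S) + op_exp (X + Y + S)"
    and "c2 \<equiv> op_exp (- X - Y - S) + op_exp (- X + Y - S)"
  shows
    "M1 \<triangleq>\<^bsub>D\<^esub> mat2 (q *\<^sub>O a1) (- b1) c1 (- (inverse q *\<^sub>O a1)) \<and>
     M2 \<triangleq>\<^bsub>D\<^esub> mat2 (q *\<^sub>O a2) (- b2) c2 (- (inverse q *\<^sub>O a2)) \<and>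
     (\<forall>(a, b, c) \<in> {(a1, b1, c1), (a2, b2, c2)}.
        q *\<^sub>O (a \<odot> b) \<doteq>\<^bsub>D\<^esub> inverse q *\<^sub>O (b \<odot> a) \<and>
        inverse q *\<^sub>O (a \<odot> c) \<doteq>\<^bsub>D\<^esub> q *\<^sub>O (c \<odot> a) \<and>
        b \<odot> c - c \<odot> b \<doteq>\<^bsub>D\<^esub> (q\<^sup>2 - inverse (q\<^sup>2)) *\<^sub>O (a \<odot> a) \<and>
        b \<odot> c \<doteq>\<^bsub>D\<^esub> q\<^sup>2 *\<^sub>O (a \<odot> a) + id) \<and>
     M1 \<otimes> M1 \<triangleq>\<^bsub>D\<^esub> scalar_mat (- mat 1) \<and>
     M2 \<otimes> M2 \<triangleq>\<^bsub>D\<^esub> scalar_mat (- mat 1) \<and>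
     inverse q *\<^sub>O (b1 \<odot> b2) \<doteq>\<^bsub>D\<^esub> q *\<^sub>O (b2 \<odot> b1) \<and>
     inverse q *\<^sub>O (c1 \<odot> c2) \<doteq>\<^bsub>D\<^esub> q *\<^sub>O (c2 \<odot> c1) \<and>
     a1 \<odot> b2 \<doteq>\<^bsub>D\<^esub> b2 \<odot> a1 \<and>
     c1 \<odot> a2 \<doteq>\<^bsub>D\<^esub> a2 \<odot> c1 \<and>
     q *\<^sub>O (c1 \<odot> b2) \<doteq>\<^bsub>D\<^esub> inverse q *\<^sub>O (b2 \<odot> c1) \<and>
     b1 \<odot> a2 \<doteq>\<^bsub>D\<^esub> a2 \<odot> b1 + (q\<^sup>2 - inverse (q\<^sup>2)) *\<^sub>O (a1 \<odot> b2) \<and>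
     a1 \<odot> c2 \<doteq>\<^bsub>D\<^esub> c2 \<odot> a1 + (q\<^sup>2 - inverse (q\<^sup>2)) *\<^sub>O (c1 \<odot> a2) \<and>
     a1 \<odot> a2 \<doteq>\<^bsub>D\<^esub> a2 \<odot> a1 + (1 - inverse (q\<^sup>2)) *\<^sub>O (b2 \<odot> c1) \<and>
     a1 \<odot> a2 \<doteq>\<^bsub>D\<^esub> a2 \<odot> a1 + (q\<^sup>2 - 1) *\<^sub>O (c1 \<odot> b2) \<and>
     (q *\<^sub>O (b1 \<odot> c2) + (q * (inverse (q\<^sup>2) - q\<^sup>2)) *\<^sub>O (a1 \<odot> a2)
       \<doteq>\<^bsub>D\<^esub> inverse q *\<^sub>O (c2 \<odot> b1) - (inverse q * (inverse (q\<^sup>2) - q\<^sup>2)) *\<^sub>O (a2 \<odot> a1))"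
proof -
  define W where "W s x y z = op_exp (lin_comb S X Y Z s x y z)" for s x y z
  have D: "csubspace D"
    using domain(2) by (simp add: exp_domain_def)
  \<comment> \<open>Self-adjointness supplies linearity on the operator's own domain, which contains
    \<open>D\<close>; invariance of \<open>D\<close> comes from \<open>exp_domain\<close>.\<close>
  have lin: "linear_on_domain D A" if "self_adjoint dA A" "D \<subseteq> dA" "A ` D \<subseteq> D" for A dA
    using that unfolding linear_on_domain_def self_adjoint_def by (meson subsetD)
  have gens: "linear_on_domain D S" "linear_on_domain D X" "linear_on_domain D Y" "linear_on_domain D Z"
    using self_adjoint domain by (auto simp: exp_domain_def intro!: lin)
  have mem: "lin_comb S X Y Z s x y z \<in> lin_combs S X Y Z" for s x y z
    by (auto simp: lin_comb_def lin_combs_def)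
  interpret heisenberg_action hbar D W
  proof
    fix s x y z s' x' y' z' :: real
    show "csubspace D" by (rule D)
    show "linear_on_domain D (W s x y z)"
      unfolding W_def
    proof (rule linear_on_domain_op_exp[OF D])
      show "linear_on_domain D (lin_comb S X Y Z s x y z)"
        unfolding lin_comb_def
        by (intro linear_on_domain_op_add linear_on_domain_op_scale gens D)
    qed (use domain(2) mem[of s x y z] in \<open>auto simp: exp_domain_def\<close>)
    have "lin_comb S X Y Z 0 0 0 0 = 0"
      by (auto simp: lin_comb_def op_scale_def)
    then show "W 0 0 0 0 = id"
      by (simp add: W_def)
    \<comment> \<open>The commutator of the exponents is \<open>2 * pi * \<i> * hbar\<close> times
      \<open>commutator_form\<close>, so the factor \<open>exp (c / 2)\<close> is q raised to that
      form.\<close>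
    show "W s x y z \<odot> W s' x' y' z' \<doteq>\<^bsub>D\<^esub>
        exp (\<i> * pi * hbar * commutator_form s x y z s' x' y' z') *\<^sub>O W (s + s') (x + x') (y + y') (z + z')"
      using exponentials[OF mem mem has_commutator_lin_comb[OF D gens commutators],
          of s x y z s' x' y' z']
      by (simp add: W_def lin_comb_add mult_ac)
  qed
  \<comment> \<open>The arguments of \<open>monomial\<close> are the exponent of q, then the
    coefficients of S, X, Y, Z. The first is 0, since each sum stands inside a single exponential
    and nothing is reordered.\<close>
  have exps:
    "op_exp (- X - Z) = monomial 0 0 (- 1) 0 (- 1)"
    "op_exp (- Z) = monomial 0 0 0 0 (- 1)"
    "op_exp (- X - Z + S) = monomial 0 1 (- 1) 0 (- 1)"
    "op_exp (- Z + S) = monomial 0 1 0 0 (- 1)"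
    "op_exp (X - Z + S) = monomial 0 1 1 0 (- 1)"
    "op_exp (X + Z + S) = monomial 0 1 1 0 1"
    "op_exp (- X - Z - S) = monomial 0 (- 1) (- 1) 0 (- 1)"
    "op_exp (- X - Y) = monomial 0 0 (- 1) (- 1) 0"
    "op_exp (- X + Y) = monomial 0 0 (- 1) 1 0"
    "op_exp Y = monomial 0 0 0 1 0"
    "op_exp (- X - Y + S) = monomial 0 1 (- 1) (- 1) 0"
    "op_exp (Y + S) = monomial 0 1 0 1 0"
    "op_exp (- X + Y + S) = monomial 0 1 (- 1) 1 0"
    "op_exp (X + Y + S) = monomial 0 1 1 1 0"
    "op_exp (- X - Y - S) = monomial 0 (- 1) (- 1) (- 1) 0"
    "op_exp (- X + Y - S) = monomial 0 (- 1) (- 1) 1 0"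
    unfolding W_monomial[symmetric] W_def
    by (auto simp: lin_comb_def op_scale_def scaleC_minus_left intro!: arg_cong[of _ _ op_exp])
  \<comment> \<open>\<open>XM\<close> halves its argument, which explains the coefficients 1/2 for S
    and X and the integral ones for \<open>2 *\<^sub>O Y\<close> and
    \<open>2 *\<^sub>O Z\<close>.\<close>
  have Xs:
    "XM S = mat2 0 (- monomial 0 (1/2) 0 0 0) (monomial 0 (- 1/2) 0 0 0) 0"
    "XM X = mat2 0 (- monomial 0 0 (1/2) 0 0) (monomial 0 0 (- 1/2) 0 0) 0"
    "XM (2 *\<^sub>O Y) = mat2 0 (- monomial 0 0 0 1 0) (monomial 0 0 0 (- 1) 0) 0"
    "XM (2 *\<^sub>O Z) = mat2 0 (- monomial 0 0 0 0 1) (monomial 0 0 0 0 (- 1)) 0"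
    unfolding XM_def W_monomial[symmetric] W_def
    by (auto simp: lin_comb_def op_scale_def scaleC_minus_left scaleC_scaleC
        intro!: arg_cong2[of _ _ _ _ "\<lambda>u v. mat2 0 (- op_exp u) (op_exp v) 0"])
  have RL: "RM = mat2 id id (- id) 0" "LM = mat2 0 id (- id) (- id)"
    by (auto simp: RM_def LM_def R0_def L0_eq scalar_mat_def vec_eq_iff forall_2 op_scale_def
        scaleC_minus_left)
  \<comment> \<open>The coefficient \<open>q + inverse q\<close> is split into two monomials with
    first coordinates 1 and -1, so \<open>b1\<close> and \<open>b2\<close> have five terms
    each.\<close>
  have a1: "a1 \<psi> = monomial 0 0 (- 1) 0 (- 1) \<psi> + monomial 0 0 0 0 (- 1) \<psi>"
    and b1: "b1 \<psi> = monomial 0 1 (- 1) 0 (- 1) \<psi> + monomial 1 1 0 0 (- 1) \<psi> + monomial (- 1) 1 0 0 (- 1) \<psi>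
      + monomial 0 1 1 0 (- 1) \<psi> + monomial 0 1 1 0 1 \<psi>"
    and c1: "c1 \<psi> = monomial 0 (- 1) (- 1) 0 (- 1) \<psi>"
    and a2: "a2 \<psi> = monomial 0 0 (- 1) (- 1) 0 \<psi> + monomial 0 0 (- 1) 1 0 \<psi> + monomial 0 0 0 1 0 \<psi>"
    and b2: "b2 \<psi> = monomial 0 1 (- 1) (- 1) 0 \<psi> + monomial 1 1 0 1 0 \<psi> + monomial (- 1) 1 0 1 0 \<psi>
      + monomial 0 1 (- 1) 1 0 \<psi> + monomial 0 1 1 1 0 \<psi>"
    and c2: "c2 \<psi> = monomial 0 (- 1) (- 1) (- 1) 0 \<psi> + monomial 0 (- 1) (- 1) 1 0 \<psi>" for \<psi>
    unfolding a1_def b1_def c1_def a2_def b2_def c2_def exps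
    by (simp_all add: monomial_simps q_def)
  have q: "q = q_pow 1"
    by (simp add: q_def q_pow_one)
  note expand = op_eq_on_def a1 b1 c1 a2 b2 c2 q monomial_simps algebra_simps
  note expand_mat = mat_eq_on_def forall_2 mat_mult_nth_apply expand
  \<comment> \<open>An entry is a sum over index paths through the nine factors. The
    \<open>XM\<close> factors stand in palindromic order, so along each path the fractional powers
    of q add up to an integral one.\<close>
  have M1: "M1 \<triangleq>\<^bsub>D\<^esub> mat2 (q *\<^sub>O a1) (- b1) c1 (- (inverse q *\<^sub>O a1))"
    unfolding M1_def Xs RL
    by (simp add: expand_mat)
  have M2: "M2 \<triangleq>\<^bsub>D\<^esub> mat2 (q *\<^sub>O a2) (- b2) c2 (- (inverse q *\<^sub>O a2))"
    unfolding M2_def Xs RL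
    by (simp add: expand_mat)
  have "q *\<^sub>O (a1 \<odot> b1) \<doteq>\<^bsub>D\<^esub> inverse q *\<^sub>O (b1 \<odot> a1)"
    and "inverse q *\<^sub>O (a1 \<odot> c1) \<doteq>\<^bsub>D\<^esub> q *\<^sub>O (c1 \<odot> a1)"
    and "b1 \<odot> c1 - c1 \<odot> b1 \<doteq>\<^bsub>D\<^esub> (q\<^sup>2 - inverse (q\<^sup>2)) *\<^sub>O (a1 \<odot> a1)"
    and "b1 \<odot> c1 \<doteq>\<^bsub>D\<^esub> q\<^sup>2 *\<^sub>O (a1 \<odot> a1) + id"
    by (simp_all add: expand)
  moreover have "q *\<^sub>O (a2 \<odot> b2) \<doteq>\<^bsub>D\<^esub> inverse q *\<^sub>O (b2 \<odot> a2)"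
    and "inverse q *\<^sub>O (a2 \<odot> c2) \<doteq>\<^bsub>D\<^esub> q *\<^sub>O (c2 \<odot> a2)"
    and "b2 \<odot> c2 - c2 \<odot> b2 \<doteq>\<^bsub>D\<^esub> (q\<^sup>2 - inverse (q\<^sup>2)) *\<^sub>O (a2 \<odot> a2)"
    and "b2 \<odot> c2 \<doteq>\<^bsub>D\<^esub> q\<^sup>2 *\<^sub>O (a2 \<odot> a2) + id"
    by (simp_all add: expand)
  ultimately have rels: "\<forall>(a, b, c) \<in> {(a1, b1, c1), (a2, b2, c2)}.
      q *\<^sub>O (a \<odot> b) \<doteq>\<^bsub>D\<^esub> inverse q *\<^sub>O (b \<odot> a) \<and>
      inverse q *\<^sub>O (a \<odot> c) \<doteq>\<^bsub>D\<^esub> q *\<^sub>O (c \<odot> a) \<and>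
      b \<odot> c - c \<odot> b \<doteq>\<^bsub>D\<^esub> (q\<^sup>2 - inverse (q\<^sup>2)) *\<^sub>O (a \<odot> a) \<and>
      b \<odot> c \<doteq>\<^bsub>D\<^esub> q\<^sup>2 *\<^sub>O (a \<odot> a) + id"
    by simp
  \<comment> \<open>Equality on \<open>D\<close> says nothing off \<open>D\<close>: the outer factor
    may be replaced by \<open>N\<close> only where the inner one has landed in \<open>D\<close>,
    hence the invariance condition. The square is then computed from the short form \<open>N\<close>
    instead of the ninefold product.\<close>
  have square: "M \<otimes> M \<triangleq>\<^bsub>D\<^esub> P"
    if "M \<triangleq>\<^bsub>D\<^esub> N" "\<forall>i j. \<forall>\<psi>\<in>D. (N $ i $ j) \<psi> \<in> D" "N \<otimes> N \<triangleq>\<^bsub>D\<^esub> P"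
    for M N P :: "('h \<Rightarrow> 'h)^2^2"
    using that by (auto simp: mat_eq_on_def op_eq_on_def mat_mult_nth_apply)
  have M1_square: "M1 \<otimes> M1 \<triangleq>\<^bsub>D\<^esub> scalar_mat (- mat 1)"
    by (rule square[OF M1]) (simp_all add: expand_mat scalar_mat_def mat_def)
  have M2_square: "M2 \<otimes> M2 \<triangleq>\<^bsub>D\<^esub> scalar_mat (- mat 1)"
    by (rule square[OF M2]) (simp_all add: expand_mat scalar_mat_def mat_def)
  show ?thesis
    by (intro conjI M1 M2 rels M1_square M2_square) (simp_all add: expand)
qed

end
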